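(* There exist a compact Hausdorff space $X$ and a uniform algebra $B$ on $X$ such that $B$ has a nontrivial Gleason part, but there are no nonzero point derivations (bounded or unbounded) on $B$ at any point of the maximal ideal space $\mathfrak{M}_B$.
   Context: A uniform algebra on a compact Hausdorff space $X$ is a subalgebra of $C(X)$ (continuous complex-valued functions, supremum norm) that is closed, contains the constant functions, and separates the points of $X$. The maximal ideal space $\mathfrak{M}_B$ is the set of nonzero multiplicative linear functionals on $B$ with the Gelfand (weak-* ) topology. For $\phi\in\mathfrak{M}_B$, a point derivation on $B$ at $\phi$ is a linear functional $\psi$ on $B$ (not assumed continuous) with $\psi(fg)=\psi(f)\phi(g)+\phi(f)\psi(g)$ for all $f,g\in B$. The Gleason parts for $B$ are the equivalence classes in $\mathfrak{M}_B$ under the equivalence relation $\phi\sim\psi$ if and only if $\|\phi-\psi\|<2$ (norm of the dual space $B^*$). A Gleason part is nontrivial if it contains more than one point. *)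

theory Defs
  imports "HOL-Analysis.Analysis"
begin

(* Elements of C(X) are extensional, i.e. undefined off topspace X, as in cfunspace.  For compact X
   the boundedness condition built into cfunspace holds automatically. *)

abbreviation CX :: "'a topology \<Rightarrow> ('a \<Rightarrow> complex) metric" where
  "CX X \<equiv> cfunspace X euclidean_metric"

definition sup_norm :: "'a topology \<Rightarrow> ('a \<Rightarrow> complex) \<Rightarrow> real" where
  "sup_norm X f = mdist (CX X) f (\<lambda>x\<in>topspace X. 0)"

definition fun_add :: "'a topology \<Rightarrow> ('a \<Rightarrow> complex) \<Rightarrow> ('a \<Rightarrow> complex) \<Rightarrow> 'a \<Rightarrow> complex" where
  "fun_add X f g = (\<lambda>x\<in>topspace X. f x + g x)"

definition fun_mult :: "'a topology \<Rightarrow> ('a \<Rightarrow> complex) \<Rightarrow> ('a \<Rightarrow> complex) \<Rightarrow> 'a \<Rightarrow> complex" where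
  "fun_mult X f g = (\<lambda>x\<in>topspace X. f x * g x)"

definition fun_scale :: "'a topology \<Rightarrow> complex \<Rightarrow> ('a \<Rightarrow> complex) \<Rightarrow> 'a \<Rightarrow> complex" where
  "fun_scale X c f = (\<lambda>x\<in>topspace X. c * f x)"

definition subalgebra :: "'a topology \<Rightarrow> ('a \<Rightarrow> complex) set \<Rightarrow> bool" where
  "subalgebra X B \<longleftrightarrow>
     B \<subseteq> mspace (CX X) \<and> B \<noteq> {} \<and>
     (\<forall>f\<in>B. \<forall>g\<in>B. fun_add X f g \<in> B) \<and>
     (\<forall>c. \<forall>f\<in>B. fun_scale X c f \<in> B) \<and>
     (\<forall>f\<in>B. \<forall>g\<in>B. fun_mult X f g \<in> B)"

definition uniform_algebra :: "'a topology \<Rightarrow> ('a \<Rightarrow> complex) set \<Rightarrow> bool" where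
  "uniform_algebra X B \<longleftrightarrow>
     compact_space X \<and> Hausdorff_space X \<and>
     subalgebra X B \<and>
     closedin (mtopology_of (CX X)) B \<and>
     (\<forall>c. (\<lambda>x\<in>topspace X. c) \<in> B) \<and>
     (\<forall>x\<in>topspace X. \<forall>y\<in>topspace X. x \<noteq> y \<longrightarrow> (\<exists>f\<in>B. f x \<noteq> f y))"

definition linear_functional ::
    "'a topology \<Rightarrow> ('a \<Rightarrow> complex) set \<Rightarrow> (('a \<Rightarrow> complex) \<Rightarrow> complex) \<Rightarrow> bool" where
  "linear_functional X B L \<longleftrightarrow>
     (\<forall>f\<in>B. \<forall>g\<in>B. L (fun_add X f g) = L f + L g) \<and>
     (\<forall>c. \<forall>f\<in>B. L (fun_scale X c f) = c * L f)"

(* Characters are made extensional so that equality of functions is equality of functionals on B. *)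

definition characters ::
    "'a topology \<Rightarrow> ('a \<Rightarrow> complex) set \<Rightarrow> (('a \<Rightarrow> complex) \<Rightarrow> complex) set" where
  "characters X B =
     {\<phi> \<in> extensional B. linear_functional X B \<phi> \<and>
        (\<forall>f\<in>B. \<forall>g\<in>B. \<phi> (fun_mult X f g) = \<phi> f * \<phi> g) \<and>
        (\<exists>f\<in>B. \<phi> f \<noteq> 0)}"

(* The Gelfand topology is the topology of pointwise convergence on B. *)

definition maximal_ideal_space ::
    "'a topology \<Rightarrow> ('a \<Rightarrow> complex) set \<Rightarrow> (('a \<Rightarrow> complex) \<Rightarrow> complex) topology" where
  "maximal_ideal_space X B =
     subtopology (product_topology (\<lambda>_. euclidean) B) (characters X B)"

(* Values in ennreal, so that an unbounded functional has norm infinity. *)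

definition dual_norm ::
    "'a topology \<Rightarrow> ('a \<Rightarrow> complex) set \<Rightarrow> (('a \<Rightarrow> complex) \<Rightarrow> complex) \<Rightarrow> ennreal" where
  "dual_norm X B L = (SUP f\<in>{f\<in>B. sup_norm X f \<le> 1}. ennreal (cmod (L f)))"

definition gleason_rel ::
    "'a topology \<Rightarrow> ('a \<Rightarrow> complex) set \<Rightarrow> (('a \<Rightarrow> complex) \<Rightarrow> complex) rel" where
  "gleason_rel X B =
     {(\<phi>, \<psi>). \<phi> \<in> topspace (maximal_ideal_space X B) \<and> \<psi> \<in> topspace (maximal_ideal_space X B) \<and>
        dual_norm X B (\<lambda>f. \<phi> f - \<psi> f) < 2}"

definition gleason_parts ::
    "'a topology \<Rightarrow> ('a \<Rightarrow> complex) set \<Rightarrow> (('a \<Rightarrow> complex) \<Rightarrow> complex) set set" where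
  "gleason_parts X B = topspace (maximal_ideal_space X B) // gleason_rel X B"

definition nontrivial_part :: "'b set \<Rightarrow> bool" where
  "nontrivial_part P \<longleftrightarrow> (\<exists>\<phi>\<in>P. \<exists>\<psi>\<in>P. \<phi> \<noteq> \<psi>)"

definition point_derivation ::
    "'a topology \<Rightarrow> ('a \<Rightarrow> complex) set \<Rightarrow> (('a \<Rightarrow> complex) \<Rightarrow> complex) \<Rightarrow>
      (('a \<Rightarrow> complex) \<Rightarrow> complex) \<Rightarrow> bool" where
  "point_derivation X B \<phi> D \<longleftrightarrow>
     linear_functional X B D \<and>
     (\<forall>f\<in>B. \<forall>g\<in>B. D (fun_mult X f g) = D f * \<phi> g + \<phi> f * D g)"

end

theory Submission
  imports Defs "HOL-Complex_Analysis.Conformal_Mappings" "HOL-Library.Multiset"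
begin

text \<open>
  The algebra arises from the disc algebra by adjoining square roots, as in Cole's construction of
  root extensions, but only square roots of functions that vanish at two chosen points \<open>p\<close> and
  \<open>q\<close>. Two observations make this work.

  Adjoining such a root keeps the distance from \<open>p\<close> to \<open>q\<close> in the dual space. If \<open>g\<close> is the root,
  every new function is, up to uniform approximation, \<open>F\<^sub>0 + F\<^sub>1 g\<close> with old \<open>F\<^sub>0\<close>, \<open>F\<^sub>1\<close>. The new
  space has an involution which replaces \<open>g\<close> by \<open>-g\<close> and fixes the old functions, so averaging over
  it shows that \<open>F\<^sub>0\<close> has norm at most that of \<open>F\<^sub>0 + F\<^sub>1 g\<close>; and both have the same values at
  \<open>p\<close> and \<open>q\<close>, as \<open>g\<close> vanishes there. Hence the estimate \<open>|F(p) - F(q)| \<le> \<parallel>F\<parallel>\<close>, which the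
  Schwarz lemma gives in the disc algebra for the points \<open>0\<close> and \<open>1/2\<close>, survives
  (\<open>difference_bound\<close>).

  Suppose that in the end every function which vanishes at \<open>p\<close> and \<open>q\<close> is a square. Let \<open>D\<close> be a
  derivation at a character \<open>\<phi>\<close>, and \<open>\<phi>(f) = 0\<close>. There are \<open>h\<close>, \<open>k\<close> not annihilated by \<open>\<phi>\<close> such
  that \<open>f h\<close> vanishes at \<open>p\<close> and \<open>f k\<close> vanishes at \<open>q\<close>: one takes \<open>h\<close> in the kernel of the
  evaluation at \<open>p\<close>, unless \<open>\<phi>\<close> is that evaluation and \<open>h = 1\<close> will do. Then
  \<open>f h k = g\<^sup>2\<close>, so \<open>\<phi>(g) = 0\<close> and \<open>D(f) \<phi>(h) \<phi>(k) = D(f h k) = 2 \<phi>(g) D(g) = 0\<close>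
  (\<open>derivation_vanishes\<close>).

  To have exact roots of all such functions, and not merely of a dense set of them, the adjunction of
  roots alternates with completion transfinitely often. Instead of a transfinite tower of spaces,
  the names of all functions ever needed form one datatype of expressions, with an infinitely
  branching constructor for limits. A point of the space is an assignment of a number to each expression which
  respects the intended meaning of the constructors, and the algebra consists of the coordinate
  functions. Induction over expressions replaces transfinite induction; there are only continuum many
  expressions, so that the space embeds into the functions on the real line.
\<close>

section \<open>Expressions and consistent assignments\<close>

text \<open>
  \<open>Base\<close> names the identity function of the closed unit disc. Every expression names a function, also
  \<open>Limit s\<close> and \<open>Root a\<close> when the sequence does not converge at the prescribed rate or the root is
  not to be adjoined: they then name the zero function.
\<close>

datatype expr =
    Base
  | Const complex
  | Plus expr expr
  | Times expr expr
  | Limit "nat \<Rightarrow> expr"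
  | Root expr

text \<open>
  Consistency at an expression constrains the values at its subexpressions only. Whether a limit or a
  root is to be formed is decided by quantifying over all assignments that are consistent so far,
  which are the points of the space constructed at that stage of the tower. Both conditions are
  inlined because they mention the recursive call; they receive names afterwards. The condition for
  roots says that the function vanishes at the two points over \<open>0\<close> and \<open>1/2\<close>. Convergence has a
  prescribed rate, so that consistency at a limit is a closed condition.
\<close>

primrec consistent :: "expr \<Rightarrow> (expr \<Rightarrow> complex) \<Rightarrow> bool" where
  "consistent Base v \<longleftrightarrow> cmod (v Base) \<le> 1"
| "consistent (Const c) v \<longleftrightarrow> v (Const c) = c"
| "consistent (Plus a b) v \<longleftrightarrow> consistent a v \<and> consistent b v \<and> v (Plus a b) = v a + v b"
| "consistent (Times a b) v \<longleftrightarrow> consistent a v \<and> consistent b v \<and> v (Times a b) = v a * v b"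
| "consistent (Limit s) v \<longleftrightarrow> (\<forall>n. consistent (s n) v) \<and>
     (if \<forall>w. (\<forall>n. consistent (s n) w) \<longrightarrow> (\<forall>n. cmod (w (s n) - w (s (Suc n))) \<le> 1 / 2 ^ n)
      then \<forall>n. cmod (v (Limit s) - v (s n)) \<le> 2 / 2 ^ n
      else v (Limit s) = 0)"
| "consistent (Root a) v \<longleftrightarrow> consistent a v \<and>
     (if \<forall>w. consistent a w \<and> w Base \<in> {0, 1/2} \<longrightarrow> w a = 0
      then (v (Root a))\<^sup>2 = v a
      else v (Root a) = 0)"

definition rapidly_convergent :: "(nat \<Rightarrow> expr) \<Rightarrow> bool" where
  "rapidly_convergent s \<longleftrightarrow>
     (\<forall>w. (\<forall>n. consistent (s n) w) \<longrightarrow> (\<forall>n. cmod (w (s n) - w (s (Suc n))) \<le> 1 / 2 ^ n))"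

definition vanishing :: "expr \<Rightarrow> bool" where
  "vanishing a \<longleftrightarrow> (\<forall>w. consistent a w \<and> w Base \<in> {0, 1/2} \<longrightarrow> w a = 0)"

lemma consistent_Limit:
  "consistent (Limit s) v \<longleftrightarrow> (\<forall>n. consistent (s n) v) \<and>
     (if rapidly_convergent s then \<forall>n. cmod (v (Limit s) - v (s n)) \<le> 2 / 2 ^ n
      else v (Limit s) = 0)"
  by (simp add: rapidly_convergent_def)

lemma consistent_Root:
  "consistent (Root a) v \<longleftrightarrow> consistent a v \<and>
     (if vanishing a then (v (Root a))\<^sup>2 = v a else v (Root a) = 0)"
  by (simp add: vanishing_def)

declare consistent.simps(5,6) [simp del]

definition points :: "(expr \<Rightarrow> complex) set" where
  "points = {v. \<forall>t. consistent t v}"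

section \<open>Extension of partial assignments\<close>

lemma rapid_limit:
  fixes c :: "nat \<Rightarrow> complex"
  assumes "\<And>n. cmod (c n - c (Suc n)) \<le> 1 / 2 ^ n"
  shows "\<exists>l. \<forall>n. cmod (l - c n) \<le> 2 / 2 ^ n"
proof -
  have far: "cmod (c (n + k) - c n) \<le> 2 / 2 ^ n - 2 / 2 ^ (n + k)" for n k
  proof (induction k)
    case (Suc k)
    have "cmod (c (n + Suc k) - c n) \<le> cmod (c (n + k) - c (Suc (n + k))) + cmod (c (n + k) - c n)"
      using norm_triangle_ineq[of "c (Suc (n + k)) - c (n + k)" "c (n + k) - c n"]
      by (simp add: norm_minus_commute)
    also have "\<dots> \<le> 1 / 2 ^ (n + k) + (2 / 2 ^ n - 2 / 2 ^ (n + k))"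
      by (intro add_mono assms Suc)
    also have "\<dots> = 2 / 2 ^ n - 2 / 2 ^ (n + Suc k)"
      by (simp add: field_simps)
    finally show ?case .
  qed simp
  have far': "cmod (c m - c n) \<le> 2 / 2 ^ n" if "n \<le> m" for m n
    using far[of n "m - n"] that by (smt (verit) le_add_diff_inverse divide_nonneg_pos zero_less_power)
  have "Cauchy c"
  proof (rule metric_CauchyI)
    fix e :: real assume "0 < e"
    then obtain N where N: "(1/2) ^ N < e / 4"
      using real_arch_pow_inv[of "e / 4" "1/2"] by auto
    have "dist (c m) (c n) < e" if "m \<ge> N" "n \<ge> N" for m n
    proof -
      have "dist (c m) (c n) \<le> dist (c m) (c N) + dist (c n) (c N)"
        by (rule dist_triangle2)
      also have "\<dots> \<le> 2 / 2 ^ N + 2 / 2 ^ N"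
        using far'[OF that(1)] far'[OF that(2)] by (intro add_mono) (simp_all add: dist_norm)
      also have "\<dots> < e"
        using N by (simp add: power_one_over)
      finally show ?thesis .
    qed
    then show "\<exists>M. \<forall>m\<ge>M. \<forall>n\<ge>M. dist (c m) (c n) < e" by blast
  qed
  then obtain l where l: "c \<longlonglongrightarrow> l"
    using Cauchy_convergent convergent_def by blast
  have "cmod (l - c n) \<le> 2 / 2 ^ n" for n
  proof (rule LIMSEQ_le_const2)
    show "(\<lambda>m. cmod (c m - c n)) \<longlonglongrightarrow> cmod (l - c n)"
      by (intro tendsto_intros l)
    show "\<exists>N. \<forall>m\<ge>N. cmod (c m - c n) \<le> 2 / 2 ^ n"
      using far' by blast
  qed
  then show ?thesis by blast
qed

text \<open>
  Values of \<open>w\<close> are kept wherever \<open>w\<close> is consistent; the other values are recomputed, with the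
  principal branch for square roots.
\<close>

primrec extend :: "(expr \<Rightarrow> complex) \<Rightarrow> expr \<Rightarrow> complex" where
  "extend w Base = (if consistent Base w then w Base else 0)"
| "extend w (Const c) = c"
| "extend w (Plus a b) = extend w a + extend w b"
| "extend w (Times a b) = extend w a * extend w b"
| "extend w (Limit s) =
     (if consistent (Limit s) w then w (Limit s)
      else if rapidly_convergent s then SOME l. \<forall>n. cmod (l - extend w (s n)) \<le> 2 / 2 ^ n
      else 0)"
| "extend w (Root a) =
     (if consistent (Root a) w then w (Root a)
      else if vanishing a then csqrt (extend w a) else 0)"

lemma extend_eq: "consistent t w \<Longrightarrow> extend w t = w t"
  by (induction t) auto

lemma consistent_extend: "consistent t (extend w)"
proof (induction t)
  case (Limit s)
  show ?case
  proof (cases "consistent (Limit s) w")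
    case True
    then have "extend w (s n) = w (s n)" for n
      by (simp add: consistent_Limit extend_eq)
    with True Limit show ?thesis
      by (simp add: consistent_Limit)
  next
    case False
    show ?thesis
    proof (cases "rapidly_convergent s")
      case True
      then have "\<And>n. cmod (extend w (s n) - extend w (s (Suc n))) \<le> 1 / 2 ^ n"
        using Limit unfolding rapidly_convergent_def by blast
      then have "\<exists>l. \<forall>n. cmod (l - extend w (s n)) \<le> 2 / 2 ^ n"
        by (rule rapid_limit)
      then have "\<forall>n. cmod ((SOME l. \<forall>n. cmod (l - extend w (s n)) \<le> 2 / 2 ^ n) - extend w (s n)) \<le> 2 / 2 ^ n"
        by (rule someI_ex)
      with False True Limit show ?thesis
        by (simp add: consistent_Limit[of s "extend w"])
    qed (use False Limit in \<open>simp add: consistent_Limit[of s "extend w"]\<close>)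
  qed
next
  case (Root a)
  show ?case
  proof (cases "consistent (Root a) w")
    case True
    then have "extend w a = w a"
      by (simp add: consistent_Root extend_eq)
    with True Root show ?thesis
      by (simp add: consistent_Root)
  qed (use Root in \<open>simp add: consistent_Root[of a "extend w"]\<close>)
qed auto

lemma extend_in_points: "extend w \<in> points"
  by (simp add: points_def consistent_extend)

text \<open>
  By extension, an assignment that is consistent on some expressions agrees on them with a point of
  the space. Therefore the conditions for forming limits and roots may be checked on points alone.
\<close>

lemma rapidly_convergentI:
  assumes "\<And>v n. v \<in> points \<Longrightarrow> cmod (v (s n) - v (s (Suc n))) \<le> 1 / 2 ^ n"
  shows "rapidly_convergent s"
  unfolding rapidly_convergent_def
  using assms[OF extend_in_points] by (metis extend_eq)

lemma vanishingI:
  assumes "\<And>v. v \<in> points \<Longrightarrow> v Base \<in> {0, 1/2} \<Longrightarrow> v a = 0"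
  shows "vanishing a"
  unfolding vanishing_def
proof (intro allI impI)
  fix w assume w: "consistent a w \<and> w Base \<in> {0, 1/2}"
  then have "w Base = 0 \<or> w Base = 1/2" by simp
  then have "consistent Base w"
  proof
    assume half: "w Base = 1/2"
    show ?thesis unfolding consistent.simps half by simp
  qed simp
  then show "w a = 0"
    using assms[OF extend_in_points, of w] w extend_eq[of Base w] extend_eq[of a w] by simp
qed

section \<open>The space of points\<close>

lemma points_Const: "v \<in> points \<Longrightarrow> v (Const c) = c"
  and points_Base: "v \<in> points \<Longrightarrow> cmod (v Base) \<le> 1"
  and points_Plus: "v \<in> points \<Longrightarrow> v (Plus a b) = v a + v b"
  and points_Times: "v \<in> points \<Longrightarrow> v (Times a b) = v a * v b"
  unfolding points_def by (auto dest: spec[of _ "Const c"] spec[of _ Base] spec[of _ "Plus a b"] spec[of _ "Times a b"])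

lemma points_Limit:
  "v \<in> points \<Longrightarrow> rapidly_convergent s \<Longrightarrow> cmod (v (Limit s) - v (s n)) \<le> 2 / 2 ^ n"
  "v \<in> points \<Longrightarrow> \<not> rapidly_convergent s \<Longrightarrow> v (Limit s) = 0"
  unfolding points_def by (auto dest!: spec[of _ "Limit s"] simp: consistent_Limit)

lemma points_Root:
  "v \<in> points \<Longrightarrow> vanishing a \<Longrightarrow> (v (Root a))\<^sup>2 = v a"
  "v \<in> points \<Longrightarrow> \<not> vanishing a \<Longrightarrow> v (Root a) = 0"
  unfolding points_def by (auto dest!: spec[of _ "Root a"] simp: consistent_Root)

lemma vanishingD: "vanishing a \<Longrightarrow> v \<in> points \<Longrightarrow> v Base \<in> {0, 1/2} \<Longrightarrow> v a = 0"
  unfolding vanishing_def points_def by blast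

lemma bounded_coordinate: "\<exists>K. \<forall>v\<in>points. cmod (v t) \<le> K"
proof (induction t)
  case Base
  then show ?case using points_Base by blast
next
  case (Const c)
  then show ?case using points_Const by force
next
  case (Plus a b)
  then obtain K L where "\<forall>v\<in>points. cmod (v a) \<le> K" "\<forall>v\<in>points. cmod (v b) \<le> L" by blast
  then have "\<forall>v\<in>points. cmod (v (Plus a b)) \<le> K + L"
    by (auto simp: points_Plus intro: norm_triangle_mono)
  then show ?case by blast
next
  case (Times a b)
  then obtain K L where KL: "\<forall>v\<in>points. cmod (v a) \<le> K" "\<forall>v\<in>points. cmod (v b) \<le> L" by blast
  then have "\<forall>v\<in>points. cmod (v (Times a b)) \<le> K * L"
    by (auto simp: points_Times norm_mult intro!: mult_mono intro: order_trans[OF norm_ge_zero])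
  then show ?case by blast
next
  case (Limit s)
  then obtain K where K: "\<forall>v\<in>points. cmod (v (s 0)) \<le> K" by blast
  have "cmod (v (Limit s)) \<le> max 0 (K + 2)" if v: "v \<in> points" for v
  proof (cases "rapidly_convergent s")
    case True
    show ?thesis
      using points_Limit(1)[OF v True, of 0] K v norm_triangle_sub[of "v (Limit s)" "v (s 0)"] by force
  qed (simp add: points_Limit v)
  then show ?case by blast
next
  case (Root a)
  then obtain K where K: "\<forall>v\<in>points. cmod (v a) \<le> K" by blast
  have "cmod (v (Root a)) \<le> max 0 (sqrt K)" if v: "v \<in> points" for v
  proof (cases "vanishing a")
    case True
    then have "(cmod (v (Root a)))\<^sup>2 \<le> K"
      using K v points_Root(1)[OF v True] by (metis norm_power)
    then show ?thesis
      using real_le_rsqrt by fastforce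
  qed (simp add: points_Root v)
  then show ?case by blast
qed

lemma closed_consistent: "closed {v. consistent t v}"
proof (induction t)
  case Base
  show ?case
    by (simp, intro closed_Collect_le continuous_intros continuous_on_product_coordinates)
next
  case (Const c)
  show ?case
    by (simp, intro closed_Collect_eq continuous_intros continuous_on_product_coordinates)
next
  case (Plus a b)
  then show ?case
    by (simp, intro closed_Collect_conj closed_Collect_eq continuous_intros continuous_on_product_coordinates)
next
  case (Times a b)
  then show ?case
    by (simp, intro closed_Collect_conj closed_Collect_eq continuous_intros continuous_on_product_coordinates)
next
  case (Limit s)
  then have "\<And>n. closed {v. consistent (s n) v}" by blast
  then show ?case unfolding consistent_Limit
    by (cases "rapidly_convergent s"; simp;
        intro closed_Collect_conj closed_Collect_all closed_Collect_le closed_Collect_eq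
          continuous_intros continuous_on_product_coordinates)
next
  case (Root a)
  then show ?case unfolding consistent_Root
    by (cases "vanishing a"; simp;
        intro closed_Collect_conj closed_Collect_eq
          continuous_intros continuous_on_product_coordinates)
qed

lemma compact_points: "compact points"
proof -
  obtain K where K: "\<And>t. \<forall>v\<in>points. cmod (v t) \<le> K t"
    using bounded_coordinate by metis
  have "compactin (product_topology (\<lambda>_. euclidean) UNIV) (PiE UNIV (\<lambda>t. cball (0::complex) (K t)))"
    by (simp add: compactin_PiE)
  then have "compact (PiE UNIV (\<lambda>t. cball (0::complex) (K t)))"
    by (simp add: euclidean_product_topology)
  moreover have "closed points"
    unfolding points_def by (intro closed_Collect_all closed_consistent)
  moreover have "points \<subseteq> PiE UNIV (\<lambda>t. cball 0 (K t))"
    using K by auto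
  ultimately show ?thesis
    by (metis compact_Int_closed inf.absorb_iff2)
qed

text \<open>The space projects onto the closed unit disc.\<close>

lemma point_over:
  assumes "cmod z \<le> 1"
  shows "\<exists>v\<in>points. v Base = z"
  by (rule bexI[OF _ extend_in_points[of "\<lambda>_. z"]]) (simp add: assms)

text \<open>
  There is no choice of roots over \<open>0\<close> and \<open>1/2\<close>: all functions whose roots are adjoined
  vanish there, and zero has just one square root.
\<close>

lemma point_over_unique:
  assumes "v \<in> points" "w \<in> points" "v Base = w Base" "v Base \<in> {0, 1/2}"
  shows "v = w"
proof
  fix t show "v t = w t"
  proof (induction t)
    case (Limit s)
    show ?case
    proof (cases "rapidly_convergent s")
      case True
      have "cmod (v (Limit s) - w (Limit s)) \<le> 4 * (1/2) ^ n" for n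
        using norm_triangle_ineq4[of "v (Limit s) - v (s n)" "w (Limit s) - w (s n)"]
          points_Limit(1)[OF assms(1) True, of n] points_Limit(1)[OF assms(2) True, of n] Limit[of "s n"]
        by (simp add: power_one_over)
      moreover have "(\<lambda>n. 4 * (1/2) ^ n :: real) \<longlonglongrightarrow> 4 * 0"
        by (intro tendsto_intros LIMSEQ_power_zero) simp
      ultimately have "cmod (v (Limit s) - w (Limit s)) \<le> 4 * 0"
        by (intro LIMSEQ_le_const[where X="\<lambda>n. 4 * (1/2) ^ n"]) blast+
      then show ?thesis by simp
    qed (simp add: points_Limit assms)
  next
    case (Root a)
    show ?case
    proof (cases "vanishing a")
      case True
      then have "v a = 0" "w a = 0"
        using vanishingD assms by metis+
      then show ?thesis
        using points_Root(1)[OF assms(1) True] points_Root(1)[OF assms(2) True] by simp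
    qed (simp add: points_Root assms)
  qed (simp_all add: assms points_Const points_Plus points_Times)
qed

section \<open>Changing the sign of one root\<close>

primrec children :: "expr \<Rightarrow> expr set" where
  "children Base = {}"
| "children (Const c) = {}"
| "children (Plus a b) = {a, b}"
| "children (Times a b) = {a, b}"
| "children (Limit s) = range s"
| "children (Root a) = {a}"

definition child_rel :: "(expr \<times> expr) set" where
  "child_rel = {(a, b). a \<in> children b}"

lemma wf_child_rel: "wf child_rel"
  unfolding child_rel_def
proof (rule wfUNIVI)
  fix P :: "expr \<Rightarrow> bool" and t
  assume *: "\<forall>t. (\<forall>a. (a, t) \<in> {(a, b). a \<in> children b} \<longrightarrow> P a) \<longrightarrow> P t"
  show "P t" by (induction t) (rule *[rule_format]; auto)+
qed

lemma not_below_child: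
  "(m, t) \<notin> child_rel\<^sup>* \<Longrightarrow> c \<in> children t \<Longrightarrow> (m, c) \<notin> child_rel\<^sup>*"
  unfolding child_rel_def by (auto intro: rtrancl_into_rtrancl)

lemma not_below_self: "(Root a, a) \<notin> child_rel\<^sup>*"
proof
  assume "(Root a, a) \<in> child_rel\<^sup>*"
  moreover have "(a, Root a) \<in> child_rel"
    by (simp add: child_rel_def)
  ultimately have "(Root a, Root a) \<in> child_rel\<^sup>+"
    by (rule rtrancl_into_trancl1)
  then show False
    using wf_acyclic[OF wf_child_rel] unfolding acyclic_def by blast
qed

lemma consistent_update:
  assumes "(m, t) \<notin> child_rel\<^sup>*"
  shows "consistent t (v(m := c)) \<longleftrightarrow> consistent t v"
  using assms
proof (induction t)
  case (Limit s)
  have below: "(m, s n) \<notin> child_rel\<^sup>*" for n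
    using not_below_child[OF Limit.prems] by simp
  then have "s n \<noteq> m" "Limit s \<noteq> m" for n
    using Limit.prems by (metis rtrancl.rtrancl_refl)+
  with Limit.IH below show ?case
    by (simp add: consistent_Limit)
next
  case (Root a)
  have below: "(m, a) \<notin> child_rel\<^sup>*"
    using not_below_child[OF Root.prems] by simp
  then have "a \<noteq> m" "Root a \<noteq> m"
    using Root.prems by auto
  with Root.IH below show ?case
    by (simp add: consistent_Root)
next
  case (Plus a b)
  have below: "(m, a) \<notin> child_rel\<^sup>*" "(m, b) \<notin> child_rel\<^sup>*"
    using not_below_child[OF Plus.prems] by simp_all
  then have "a \<noteq> m" "b \<noteq> m" "Plus a b \<noteq> m"
    using Plus.prems by auto
  with Plus.IH below show ?case
    by simp
next
  case (Times a b)
  have below: "(m, a) \<notin> child_rel\<^sup>*" "(m, b) \<notin> child_rel\<^sup>*"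
    using not_below_child[OF Times.prems] by simp_all
  then have "a \<noteq> m" "b \<noteq> m" "Times a b \<noteq> m"
    using Times.prems by auto
  with Times.IH below show ?case
    by simp
qed auto

text \<open>
  The involution of the double cover that adjoins a root. Extension carries it to all later stages,
  where it leaves alone every function whose construction does not involve that root.
\<close>

lemma sign_change:
  assumes "v \<in> points" and a: "vanishing a"
  shows "\<exists>v'\<in>points. v' (Root a) = - v (Root a) \<and>
           (\<forall>t. (Root a, t) \<notin> child_rel\<^sup>* \<longrightarrow> v' t = v t)"
proof -
  define w where "w = v(Root a := - v (Root a))"
  have cons: "consistent t w" if "(Root a, t) \<notin> child_rel\<^sup>*" for t
    using consistent_update[OF that] assms(1) by (simp add: w_def points_def)
  have "a \<noteq> Root a"
    using not_below_self[of a] by (metis rtrancl.rtrancl_refl)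
  then have "(w (Root a))\<^sup>2 = w a"
    using points_Root(1)[OF assms] by (simp add: w_def)
  with cons[OF not_below_self] a have "consistent (Root a) w"
    by (simp add: consistent_Root)
  then have "extend w (Root a) = - v (Root a)"
    using extend_eq[of "Root a" w] by (simp add: w_def)
  moreover have "extend w t = v t" if t: "(Root a, t) \<notin> child_rel\<^sup>*" for t
  proof -
    from t have "t \<noteq> Root a" by auto
    then show ?thesis
      using extend_eq[OF cons[OF t]] by (simp add: w_def)
  qed
  ultimately show ?thesis
    using extend_in_points by blast
qed

section \<open>Polynomials in finitely many coordinates\<close>

inductive_set polynomials :: "expr set \<Rightarrow> ((expr \<Rightarrow> complex) \<Rightarrow> complex) set" for M where
  const: "(\<lambda>v. c) \<in> polynomials M"
| base: "(\<lambda>v. v Base) \<in> polynomials M"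
| coord: "t \<in> M \<Longrightarrow> (\<lambda>v. v t) \<in> polynomials M"
| add: "F \<in> polynomials M \<Longrightarrow> G \<in> polynomials M \<Longrightarrow> (\<lambda>v. F v + G v) \<in> polynomials M"
| mult: "F \<in> polynomials M \<Longrightarrow> G \<in> polynomials M \<Longrightarrow> (\<lambda>v. F v * G v) \<in> polynomials M"

lemma polynomials_cong:
  assumes "F \<in> polynomials M" "v Base = w Base" "\<And>t. t \<in> M \<Longrightarrow> v t = w t"
  shows "F v = F w"
  using assms by induction auto

lemma polynomials_mono:
  assumes "F \<in> polynomials M" "M \<subseteq> N"
  shows "F \<in> polynomials N"
  using assms by induction (auto intro: polynomials.intros)

lemma polynomials_bounded:
  assumes "F \<in> polynomials M"
  shows "\<exists>K>0. \<forall>v\<in>points. cmod (F v) \<le> K"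
proof -
  have pos: "\<exists>K>0. \<forall>v\<in>points. cmod (G v) \<le> K" if "\<forall>v\<in>points. cmod (G v) \<le> K" for G :: "_ \<Rightarrow> complex" and K
    using that by (intro exI[of _ "max 1 K"]) auto
  show ?thesis
    using assms
  proof induction
    case (add F G)
    then obtain K L where "\<forall>v\<in>points. cmod (F v) \<le> K" "\<forall>v\<in>points. cmod (G v) \<le> L" by blast
    then have "\<forall>v\<in>points. cmod (F v + G v) \<le> K + L"
      by (auto intro: norm_triangle_mono)
    then show ?case by (rule pos)
  next
    case (mult F G)
    then obtain K L where "\<forall>v\<in>points. cmod (F v) \<le> K" "\<forall>v\<in>points. cmod (G v) \<le> L" by blast
    then have "\<forall>v\<in>points. cmod (F v * G v) \<le> K * L"
      by (auto simp: norm_mult intro!: mult_mono intro: order_trans[OF norm_ge_zero])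
    then show ?case by (rule pos)
  next
    case (const c)
    show ?case by (rule pos[of _ "cmod c"]) simp
  next
    case base
    obtain K where "\<forall>v\<in>points. cmod (v Base) \<le> K" using bounded_coordinate by blast
    then show ?case by (rule pos)
  next
    case (coord t)
    obtain K where "\<forall>v\<in>points. cmod (v t) \<le> K" using bounded_coordinate by blast
    then show ?case by (rule pos)
  qed
qed

text \<open>
  Replacing one variable by a uniformly close polynomial in other variables changes the value little.
\<close>

lemma polynomials_substitute:
  assumes "F \<in> polynomials (insert m N)" "0 < e"
  shows "\<exists>d>0. \<forall>S G. N \<subseteq> S \<longrightarrow> G \<in> polynomials S \<longrightarrow> (\<forall>v\<in>points. cmod (v m - G v) \<le> d) \<longrightarrow>
           (\<exists>F'\<in>polynomials S. \<forall>v\<in>points. cmod (F v - F' v) \<le> e)"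
  using assms
proof (induction arbitrary: e)
  case (const c)
  then show ?case
    by (auto intro!: exI[of _ 1] bexI[OF _ polynomials.const[of c]])
next
  case base
  then show ?case
    by (auto intro!: exI[of _ 1] bexI[OF _ polynomials.base])
next
  case (coord t)
  show ?case
  proof (cases "t = m")
    case True
    then show ?thesis using coord by blast
  next
    case False
    then show ?thesis using coord
      by (auto intro!: exI[of _ 1] bexI[OF _ polynomials.coord[of t]])
  qed
next
  case (add F G)
  from add.prems have e: "0 < e / 2" by simp
  obtain d1 where d1: "d1 > 0" "\<And>S H. N \<subseteq> S \<Longrightarrow> H \<in> polynomials S \<Longrightarrow> (\<forall>v\<in>points. cmod (v m - H v) \<le> d1) \<Longrightarrow>
           (\<exists>F'\<in>polynomials S. \<forall>v\<in>points. cmod (F v - F' v) \<le> e / 2)"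
    using add.IH(1)[OF e] by blast
  obtain d2 where d2: "d2 > 0" "\<And>S H. N \<subseteq> S \<Longrightarrow> H \<in> polynomials S \<Longrightarrow> (\<forall>v\<in>points. cmod (v m - H v) \<le> d2) \<Longrightarrow>
           (\<exists>G'\<in>polynomials S. \<forall>v\<in>points. cmod (G v - G' v) \<le> e / 2)"
    using add.IH(2)[OF e] by blast
  have "\<exists>F'\<in>polynomials S. \<forall>v\<in>points. cmod (F v + G v - F' v) \<le> e"
    if S: "N \<subseteq> S" "H \<in> polynomials S" "\<forall>v\<in>points. cmod (v m - H v) \<le> min d1 d2" for S H
  proof -
    obtain F' where F': "F' \<in> polynomials S" "\<forall>v\<in>points. cmod (F v - F' v) \<le> e / 2"
      using d1(2)[of S H] S by auto
    obtain G' where G': "G' \<in> polynomials S" "\<forall>v\<in>points. cmod (G v - G' v) \<le> e / 2"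
      using d2(2)[of S H] S by auto
    have "cmod (F v + G v - (F' v + G' v)) \<le> e" if "v \<in> points" for v
      using norm_triangle_mono[of "F v - F' v" "e/2" "G v - G' v" "e/2"] F' G' that
      by (simp add: algebra_simps)
    then show ?thesis
      using polynomials.add[OF F'(1) G'(1)] by (intro bexI) auto
  qed
  then show ?case
    using d1(1) d2(1) by (intro exI[of _ "min d1 d2"]) auto
next
  case (mult F G)
  obtain K where K: "K > 0" "\<forall>v\<in>points. cmod (F v) \<le> K"
    using polynomials_bounded[OF mult.hyps(1)] by blast
  obtain L where L: "L > 0" "\<forall>v\<in>points. cmod (G v) \<le> L"
    using polynomials_bounded[OF mult.hyps(2)] by blast
  \<comment> \<open>\<open>K + e1\<close> will bound the approximation of \<open>F\<close>, which multiplies the error in \<open>G\<close>.\<close>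
  define e1 where "e1 = e / (2 * L)"
  define e2 where "e2 = e / (2 * (K + e1))"
  have e1: "0 < e1" using mult.prems L by (simp add: e1_def)
  have e2: "0 < e2" using mult.prems K e1 by (simp add: e2_def)
  obtain d1 where d1: "d1 > 0" "\<And>S H. N \<subseteq> S \<Longrightarrow> H \<in> polynomials S \<Longrightarrow> (\<forall>v\<in>points. cmod (v m - H v) \<le> d1) \<Longrightarrow>
           (\<exists>F'\<in>polynomials S. \<forall>v\<in>points. cmod (F v - F' v) \<le> e1)"
    using mult.IH(1)[OF e1] by blast
  obtain d2 where d2: "d2 > 0" "\<And>S H. N \<subseteq> S \<Longrightarrow> H \<in> polynomials S \<Longrightarrow> (\<forall>v\<in>points. cmod (v m - H v) \<le> d2) \<Longrightarrow>
           (\<exists>G'\<in>polynomials S. \<forall>v\<in>points. cmod (G v - G' v) \<le> e2)"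
    using mult.IH(2)[OF e2] by blast
  have "\<exists>F'\<in>polynomials S. \<forall>v\<in>points. cmod (F v * G v - F' v) \<le> e"
    if S: "N \<subseteq> S" "H \<in> polynomials S" "\<forall>v\<in>points. cmod (v m - H v) \<le> min d1 d2" for S H
  proof -
    obtain F' where F': "F' \<in> polynomials S" "\<forall>v\<in>points. cmod (F v - F' v) \<le> e1"
      using d1(2)[of S H] S by auto
    obtain G' where G': "G' \<in> polynomials S" "\<forall>v\<in>points. cmod (G v - G' v) \<le> e2"
      using d2(2)[of S H] S by auto
    have "cmod (F v * G v - F' v * G' v) \<le> e" if v: "v \<in> points" for v
    proof -
      have "cmod (F' v) \<le> K + e1"
        using K(2) F'(2) v norm_triangle_ineq3[of "F' v" "F v"] by (smt (verit) norm_minus_commute)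
      then have "cmod (F' v * (G v - G' v)) \<le> (K + e1) * e2"
        unfolding norm_mult using G'(2) v K e1 by (intro mult_mono) auto
      moreover have "cmod ((F v - F' v) * G v) \<le> e1 * L"
        unfolding norm_mult using F'(2) L v e1 by (intro mult_mono) auto
      moreover have "e1 * L = e / 2"
        using L(1) by (simp add: e1_def)
      moreover have "(K + e1) * e2 = e / 2"
      proof -
        have "K + e1 \<noteq> 0" using K(1) e1 by simp
        then show ?thesis unfolding e2_def by (simp add: divide_simps)
      qed
      ultimately show ?thesis
        using norm_triangle_ineq[of "(F v - F' v) * G v" "F' v * (G v - G' v)"]
        by (simp add: algebra_simps)
    qed
    then show ?thesis
      using polynomials.mult[OF F'(1) G'(1)] by (intro bexI) auto
  qed
  then show ?case
    using d1(1) d2(1) by (intro exI[of _ "min d1 d2"]) auto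
qed

text \<open>Division by the equation of the root: even powers of the root are powers of \<open>a\<close>.\<close>

lemma polynomials_Root_split:
  assumes "F \<in> polynomials (insert (Root a) N)" "vanishing a"
  shows "\<exists>F0\<in>polynomials (insert a N). \<exists>F1\<in>polynomials (insert a N).
           \<forall>v\<in>points. F v = F0 v + F1 v * v (Root a)"
  using assms(1)
proof induction
  case (const c)
  show ?case
    by (rule bexI[OF bexI[OF _ polynomials.const[of 0]] polynomials.const[of c]]) simp
next
  case base
  show ?case
    by (rule bexI[OF bexI[OF _ polynomials.const[of 0]] polynomials.base]) simp
next
  case (coord t)
  show ?case
  proof (cases "t = Root a")
    case True
    then show ?thesis
      by (intro bexI[OF bexI[OF _ polynomials.const[of 1]] polynomials.const[of 0]]) simp
  next
    case False
    with coord have "t \<in> insert a N" by auto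
    then show ?thesis
      by (intro bexI[OF bexI[OF _ polynomials.const[of 0]] polynomials.coord[of t]]) simp_all
  qed
next
  case (add F G)
  then obtain F0 F1 G0 G1 where
    FG: "F0 \<in> polynomials (insert a N)" "F1 \<in> polynomials (insert a N)"
     "G0 \<in> polynomials (insert a N)" "G1 \<in> polynomials (insert a N)"
     "\<forall>v\<in>points. F v = F0 v + F1 v * v (Root a)" "\<forall>v\<in>points. G v = G0 v + G1 v * v (Root a)"
    by blast
  show ?case
    by (rule bexI[OF bexI[OF _ polynomials.add[OF FG(2,4)]] polynomials.add[OF FG(1,3)]])
       (simp add: FG algebra_simps)
next
  case (mult F G)
  then obtain F0 F1 G0 G1 where
    FG: "F0 \<in> polynomials (insert a N)" "F1 \<in> polynomials (insert a N)"
     "G0 \<in> polynomials (insert a N)" "G1 \<in> polynomials (insert a N)"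
     "\<forall>v\<in>points. F v = F0 v + F1 v * v (Root a)" "\<forall>v\<in>points. G v = G0 v + G1 v * v (Root a)"
    by blast
  have "(\<lambda>v. v a) \<in> polynomials (insert a N)"
    by (simp add: polynomials.coord)
  note 0 = polynomials.add[OF polynomials.mult[OF FG(1,3)] polynomials.mult[OF polynomials.mult[OF FG(2,4)] this]]
  note 1 = polynomials.add[OF polynomials.mult[OF FG(1,4)] polynomials.mult[OF FG(2,3)]]
  have "F v * G v = F0 v * G0 v + F1 v * G1 v * v a + (F0 v * G1 v + F1 v * G0 v) * v (Root a)"
    if "v \<in> points" for v
    using FG(5,6) points_Root(1)[OF that assms(2), symmetric] that
    by (simp add: algebra_simps power2_eq_square)
  then show ?case
    by (intro bexI[OF bexI[OF _ 1] 0]) blast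
qed

section \<open>The distance between the points over 0 and 1/2\<close>

text \<open>
  The Schwarz lemma, applied to \<open>(f - f(0)) / 2(K + e)\<close>, where \<open>e\<close> ensures that the values lie in
  the open disc.
\<close>

lemma Schwarz_difference:
  assumes holf: "f holomorphic_on UNIV" and K: "\<And>z. cmod z \<le> 1 \<Longrightarrow> cmod (f z) \<le> K"
  shows "cmod (f 0 - f (1/2)) \<le> K"
proof (rule field_le_epsilon)
  fix e :: real assume "0 < e"
  have "0 \<le> K" using K[of 0] norm_ge_zero[of "f 0"] by (simp add: order_trans[OF norm_ge_zero])
  define L where "L = complex_of_real (2 * (K + e))"
  have L: "cmod L = 2 * (K + e)" "L \<noteq> 0"
    using \<open>0 < e\<close> \<open>0 \<le> K\<close> by (simp_all add: L_def norm_mult flip: of_real_add)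
  have "cmod ((f (1/2) - f 0) / L) \<le> cmod (1/2)"
  proof (rule Schwarz_Lemma(1)[where f="\<lambda>z. (f z - f 0) / L"])
    show "(\<lambda>z. (f z - f 0) / L) holomorphic_on ball 0 1"
      using holomorphic_on_subset[OF holf] L by (intro holomorphic_intros) auto
    fix z :: complex assume "cmod z < 1"
    then have "cmod (f z - f 0) \<le> K + K"
      using K[of z] K[of 0] norm_triangle_ineq4[of "f z" "f 0"] by simp
    then show "cmod ((f z - f 0) / L) < 1"
      using \<open>0 < e\<close> \<open>0 \<le> K\<close> unfolding norm_divide L by (simp add: field_simps)
  qed (auto simp: norm_divide)
  then show "cmod (f 0 - f (1/2)) \<le> K + e"
    using \<open>0 < e\<close> \<open>0 \<le> K\<close> unfolding norm_divide L by (simp add: field_simps norm_minus_commute)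
qed

lemma polynomials_empty:
  assumes "F \<in> polynomials {}"
  shows "\<exists>f. f holomorphic_on UNIV \<and> (\<forall>v. F v = f (v Base))"
  using assms
proof induction
  case (const c)
  then show ?case by (intro exI[of _ "\<lambda>_. c"]) auto
next
  case base
  then show ?case by (intro exI[of _ "\<lambda>z. z"]) auto
next
  case (add F G)
  then obtain f g where fg: "f holomorphic_on UNIV" "\<forall>v. F v = f (v Base)" "g holomorphic_on UNIV" "\<forall>v. G v = g (v Base)" by blast
  then show ?case by (intro exI[of _ "\<lambda>z. f z + g z"]) (auto intro: holomorphic_intros)
next
  case (mult F G)
  then obtain f g where fg: "f holomorphic_on UNIV" "\<forall>v. F v = f (v Base)" "g holomorphic_on UNIV" "\<forall>v. G v = g (v Base)" by blast
  then show ?case by (intro exI[of _ "\<lambda>z. f z * g z"]) (auto intro: holomorphic_intros)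
qed auto

text \<open>
  Every coordinate other than an adjoined root is a uniform limit of polynomials in the coordinates of
  its immediate subexpressions.
\<close>

lemma approximate_by_children:
  assumes "\<And>a. m = Root a \<Longrightarrow> \<not> vanishing a" "0 < d"
  shows "\<exists>K G. (\<forall>b\<in>#K. (b, m) \<in> child_rel) \<and> G \<in> polynomials (set_mset K) \<and>
           (\<forall>v\<in>points. cmod (v m - G v) \<le> d)"
proof (cases m)
  case Base
  then show ?thesis
    using assms(2) by (intro exI[of _ "{#}"] exI[of _ "\<lambda>v. v Base"]) (auto intro: polynomials.intros)
next
  case (Const c)
  then show ?thesis
    using assms(2) by (intro exI[of _ "{#}"] exI[of _ "\<lambda>v. c"]) (auto intro: polynomials.intros simp: points_Const)
next
  case (Plus a b)
  then show ?thesis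
    using assms(2) by (intro exI[of _ "{#a, b#}"] exI[of _ "\<lambda>v. v a + v b"])
      (auto intro!: polynomials.intros simp: points_Plus child_rel_def)
next
  case (Times a b)
  then show ?thesis
    using assms(2) by (intro exI[of _ "{#a, b#}"] exI[of _ "\<lambda>v. v a * v b"])
      (auto intro!: polynomials.intros simp: points_Times child_rel_def)
next
  case (Limit s)
  show ?thesis
  proof (cases "rapidly_convergent s")
    case True
    obtain n where n: "(1/2) ^ n < d / 2"
      using real_arch_pow_inv[of "d / 2" "1/2"] assms(2) by auto
    have "cmod (v (Limit s) - v (s n)) \<le> d" if "v \<in> points" for v
      using points_Limit(1)[OF that True, of n] n by (simp add: power_one_over)
    then show ?thesis
      using Limit by (intro exI[of _ "{#s n#}"] exI[of _ "\<lambda>v. v (s n)"])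
        (auto intro!: polynomials.intros simp: child_rel_def)
  next
    case False
    then show ?thesis
      using assms(2) Limit by (intro exI[of _ "{#}"] exI[of _ "\<lambda>v. 0"])
        (auto intro: polynomials.intros simp: points_Limit)
  qed
next
  case (Root a)
  then show ?thesis
    using assms by (intro exI[of _ "{#}"] exI[of _ "\<lambda>v. 0"])
      (auto intro: polynomials.intros simp: points_Root)
qed

lemma exists_maximal:
  assumes "M \<noteq> {#}"
  shows "\<exists>m\<in>#M. \<forall>t\<in>#M. t \<noteq> m \<longrightarrow> (m, t) \<notin> child_rel\<^sup>*"
proof -
  have "\<exists>m\<in>set_mset M. \<forall>t\<in>set_mset M. t \<noteq> m \<longrightarrow> \<not> (m, t) \<in> child_rel\<^sup>+"
  proof (rule Finite_Set.bex_max_element)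
    show "asymp_on (set_mset M) (\<lambda>x y. (x, y) \<in> child_rel\<^sup>+)"
      using wf_acyclic[OF wf_child_rel] unfolding acyclic_def asymp_on_def by (meson trancl_trans)
    show "transp_on (set_mset M) (\<lambda>x y. (x, y) \<in> child_rel\<^sup>+)"
      unfolding transp_on_def by (meson trancl_trans)
  qed (use assms in auto)
  then show ?thesis
    by (metis rtranclD)
qed

text \<open>
  Induction over the multiset of variables: in each step one variable is replaced by finitely many of
  its immediate subexpressions, which terminates since multisets over a well-founded relation are
  well-founded. The variable is chosen not to occur in the construction of the others, so that the
  sign change, when it is an adjoined root, leaves the other variables alone. When no variables
  besides \<open>Base\<close> remain, the function is holomorphic on the disc.
\<close>

lemma difference_bound_polynomials:
  assumes p: "p \<in> points" "p Base = 0" and q: "q \<in> points" "q Base = 1/2"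
  assumes "F \<in> polynomials (set_mset M)" "\<And>v. v \<in> points \<Longrightarrow> cmod (F v) \<le> K"
  shows "cmod (F p - F q) \<le> K"
  using wf_mult1[OF wf_child_rel] assms(5,6)
proof (induction M arbitrary: F K rule: wf_induct_rule)
  case (less M)
  show ?case
  proof (cases "M = {#}")
    case True
    then obtain f where f: "f holomorphic_on UNIV" "\<And>v. F v = f (v Base)"
      using polynomials_empty less.prems(1) by force
    have "cmod (f z) \<le> K" if "cmod z \<le> 1" for z
      using point_over[OF that] less.prems(2) f(2) by metis
    then show ?thesis
      using Schwarz_difference[OF f(1)] by (simp add: f(2) p q)
  next
    case False
    then obtain m N where M: "M = add_mset m N" and max: "\<And>t. t \<in># N \<Longrightarrow> t \<noteq> m \<Longrightarrow> (m, t) \<notin> child_rel\<^sup>*"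
      using exists_maximal by (metis insert_DiffM union_single_eq_member add_mset_remove_trivial in_diffD)
    have smaller: "(N + L, M) \<in> mult1 child_rel" if "\<And>b. b \<in># L \<Longrightarrow> (b, m) \<in> child_rel" for L
      using that M by (intro mult1I) auto
    consider (repeated) "m \<in># N" | (root) a where "m = Root a" "vanishing a" "m \<notin># N"
      | (other) "\<And>a. m = Root a \<Longrightarrow> \<not> vanishing a" by blast
    then show ?thesis
    proof cases
      case repeated
      then have "F \<in> polynomials (set_mset (N + {#}))"
        using less.prems(1) by (simp add: M insert_absorb)
      from less.IH[OF smaller this less.prems(2)] show ?thesis by simp
    next
      case root
      then obtain F0 F1 where F: "F0 \<in> polynomials (insert a (set_mset N))"
          "F1 \<in> polynomials (insert a (set_mset N))"
          "\<forall>v\<in>points. F v = F0 v + F1 v * v (Root a)"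
        using polynomials_Root_split less.prems(1) unfolding M by (metis set_mset_add_mset_insert)
      have base: "(Root a, Base) \<notin> child_rel\<^sup>*"
        by (auto simp: child_rel_def elim: rtranclE)
      \<comment> \<open>\<open>F0\<close> is the average of \<open>F\<close> over the two signs of the root.\<close>
      have "cmod (F0 v) \<le> K" if v: "v \<in> points" for v
      proof -
        obtain v' where v': "v' \<in> points" "v' (Root a) = - v (Root a)"
            "\<And>t. (Root a, t) \<notin> child_rel\<^sup>* \<Longrightarrow> v' t = v t"
          using sign_change[OF v root(2)] by blast
        have same: "v' t = v t" if "t \<in> insert a (set_mset N)" for t
          using that max[of t] root not_below_self[of a] v'(3) by auto
        have "F0 v' = F0 v" "F1 v' = F1 v"
          using same v'(3)[OF base] by (auto intro!: polynomials_cong[OF F(1)] polynomials_cong[OF F(2)])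
        then have "2 * F0 v = F v + F v'"
          using F(3) v v'(1,2) by simp
        then have "2 * cmod (F0 v) \<le> cmod (F v) + cmod (F v')"
          by (metis norm_triangle_ineq norm_mult norm_numeral)
        then show ?thesis
          using less.prems(2)[OF v] less.prems(2)[OF v'(1)] by linarith
      qed
      moreover have "(N + {#a#}, M) \<in> mult1 child_rel"
        using root by (intro smaller) (auto simp: child_rel_def)
      moreover have "F0 \<in> polynomials (set_mset (N + {#a#}))"
        using F(1) by simp
      ultimately have "cmod (F0 p - F0 q) \<le> K"
        using less.IH by blast
      moreover have "p (Root a) = 0" "q (Root a) = 0"
        using vanishingD[OF root(2) p(1)] vanishingD[OF root(2) q(1)]
          points_Root(1)[OF p(1) root(2)] points_Root(1)[OF q(1) root(2)] p(2) q(2) by simp_all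
      ultimately show ?thesis
        using F(3) p(1) q(1) by simp
    next
      case other
      show ?thesis
      proof (rule field_le_epsilon)
        fix e :: real assume "0 < e"
        then have e: "0 < e / 3" by simp
        have "F \<in> polynomials (insert m (set_mset N))"
          using less.prems(1) M by simp
        from polynomials_substitute[OF this e] obtain d where d: "d > 0"
          "\<And>S G. set_mset N \<subseteq> S \<Longrightarrow> G \<in> polynomials S \<Longrightarrow> \<forall>v\<in>points. cmod (v m - G v) \<le> d \<Longrightarrow>
             \<exists>F'\<in>polynomials S. \<forall>v\<in>points. cmod (F v - F' v) \<le> e / 3" by blast
        obtain L G where L: "\<forall>b\<in>#L. (b, m) \<in> child_rel" "G \<in> polynomials (set_mset L)"
            "\<forall>v\<in>points. cmod (v m - G v) \<le> d"
          using approximate_by_children[OF other d(1)] by blast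
        obtain F' where F': "F' \<in> polynomials (set_mset (N + L))" "\<forall>v\<in>points. cmod (F v - F' v) \<le> e / 3"
          using d(2)[of "set_mset (N + L)" G] L(3) polynomials_mono[OF L(2), of "set_mset (N + L)"] by auto
        have "cmod (F' v) \<le> K + e / 3" if "v \<in> points" for v
          using less.prems(2)[OF that] F'(2) that norm_triangle_ineq3[of "F' v" "F v"]
          by (smt (verit) norm_minus_commute)
        then have "cmod (F' p - F' q) \<le> K + e / 3"
          using less.IH[OF smaller F'(1)] L(1) by blast
        moreover have "cmod (F p - F' p) \<le> e / 3" "cmod (F q - F' q) \<le> e / 3"
          using F'(2) p q by auto
        moreover have "F p - F q = (F' p - F' q) + ((F p - F' p) - (F q - F' q))"
          by simp
        ultimately show "cmod (F p - F q) \<le> K + e"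
          using norm_triangle_ineq[of "F' p - F' q" "(F p - F' p) - (F q - F' q)"]
            norm_triangle_ineq4[of "F p - F' p" "F q - F' q"] by simp
      qed
    qed
  qed
qed

lemma difference_bound:
  assumes "p \<in> points" "p Base = 0" "q \<in> points" "q Base = 1/2"
  assumes "\<And>v. v \<in> points \<Longrightarrow> cmod (v t) \<le> K"
  shows "cmod (p t - q t) \<le> K"
  using difference_bound_polynomials[OF assms(1-4), of "\<lambda>v. v t" "{#t#}"] assms(5)
  by (simp add: polynomials.coord)

section \<open>Expressions as real numbers\<close>

text \<open>
  An infinitely branching tree is determined by its labels as a function of the path from the root.
  Below the node of a constant, the paths starting with \<open>0\<close> and with \<open>1\<close> carry its real and
  imaginary parts.
\<close>

primrec encode :: "expr \<Rightarrow> nat list \<Rightarrow> real" where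
  "encode Base = (\<lambda>p. 0)"
| "encode (Const c) = (\<lambda>p. case p of [] \<Rightarrow> 1 | n # p' \<Rightarrow> if n = 0 then Re c else Im c)"
| "encode (Plus a b) = (\<lambda>p. case p of [] \<Rightarrow> 2 | n # p' \<Rightarrow> if n = 0 then encode a p' else encode b p')"
| "encode (Times a b) = (\<lambda>p. case p of [] \<Rightarrow> 3 | n # p' \<Rightarrow> if n = 0 then encode a p' else encode b p')"
| "encode (Limit s) = (\<lambda>p. case p of [] \<Rightarrow> 4 | n # p' \<Rightarrow> encode (s n) p')"
| "encode (Root a) = (\<lambda>p. case p of [] \<Rightarrow> 5 | n # p' \<Rightarrow> encode a p')"

lemma encode_inject: "encode t = encode u \<Longrightarrow> t = u"
proof (induction t arbitrary: u)
  case Base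
  show ?case using fun_cong[OF Base, of "[]"] by (cases u) auto
next
  case (Const c)
  show ?case
    using fun_cong[OF Const, of "[]"] fun_cong[OF Const, of "[0]"] fun_cong[OF Const, of "[1]"]
    by (cases u) (auto simp: complex_eq_iff)
next
  case (Plus a b)
  have eq: "encode (Plus a b) (n # p) = encode u (n # p)" for n p using Plus.prems by simp
  show ?case
    using fun_cong[OF Plus.prems, of "[]"] eq[of 0] eq[of 1] Plus.IH by (cases u) (auto simp: fun_eq_iff)
next
  case (Times a b)
  have eq: "encode (Times a b) (n # p) = encode u (n # p)" for n p using Times.prems by simp
  show ?case
    using fun_cong[OF Times.prems, of "[]"] eq[of 0] eq[of 1] Times.IH by (cases u) (auto simp: fun_eq_iff)
next
  case (Limit s)
  have eq: "encode (Limit s) (n # p) = encode u (n # p)" for n p using Limit.prems by simp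
  show ?case
    using fun_cong[OF Limit.prems, of "[]"] eq Limit.IH by (cases u) (auto simp: fun_eq_iff)
next
  case (Root a)
  have eq: "encode (Root a) (n # p) = encode u (n # p)" for n p using Root.prems by simp
  show ?case
    using fun_cong[OF Root.prems, of "[]"] eq Root.IH by (cases u) (auto simp: fun_eq_iff)
qed

text \<open>
  Real numbers are as many as sets of naturals, and countable families of sets of naturals can be
  merged into one such set.
\<close>

lemma exists_code: "\<exists>f :: expr \<Rightarrow> real. inj f"
proof -
  obtain g :: "real \<Rightarrow> nat set" where g: "inj g"
    using nat_sets_eqpoll_reals eqpoll_sym unfolding eqpoll_def bij_betw_def by blast
  obtain h :: "nat set \<Rightarrow> real" where h: "inj h"
    using nat_sets_eqpoll_reals unfolding eqpoll_def bij_betw_def by blast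
  have "inj (\<lambda>f :: nat list \<Rightarrow> real. to_nat ` (SIGMA p:UNIV. g (f p)))"
  proof (rule injI)
    fix f f' :: "nat list \<Rightarrow> real"
    assume "to_nat ` (SIGMA p:UNIV. g (f p)) = to_nat ` (SIGMA p:UNIV. g (f' p))"
    then have "(SIGMA p:UNIV. g (f p)) = (SIGMA p:UNIV. g (f' p))"
      by (simp add: inj_image_eq_iff)
    then have "g (f p) = g (f' p)" for p by (auto simp: set_eq_iff)
    then show "f = f'" using g by (auto simp: inj_def)
  qed
  moreover have "inj encode" by (auto intro: injI encode_inject)
  ultimately have "inj (h \<circ> (\<lambda>f. to_nat ` (SIGMA p:UNIV. g (f p))) \<circ> encode)"
    using h by (intro inj_compose)
  then show ?thesis by blast
qed

definition code :: "expr \<Rightarrow> real" where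
  "code = (SOME f. inj f)"

lemma inj_code: "inj code"
  unfolding code_def by (rule someI_ex[OF exists_code])

section \<open>The uniform algebra\<close>

text \<open>A copy of an assignment whose coordinates are indexed by real numbers.\<close>

definition realize :: "(expr \<Rightarrow> complex) \<Rightarrow> real \<Rightarrow> complex" where
  "realize v = (\<lambda>r. v (inv code r))"

lemma realize_code [simp]: "realize v (code t) = v t"
  by (simp add: realize_def inj_code)

definition tower_space :: "(real \<Rightarrow> complex) topology" where
  "tower_space = top_of_set (realize ` points)"

lemma topspace_tower_space [simp]: "topspace tower_space = realize ` points"
  by (simp add: tower_space_def)

definition coordinate :: "expr \<Rightarrow> (real \<Rightarrow> complex) \<Rightarrow> complex" where
  "coordinate t = (\<lambda>u\<in>realize ` points. u (code t))"

definition tower_algebra :: "((real \<Rightarrow> complex) \<Rightarrow> complex) set" where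
  "tower_algebra = range coordinate"

lemma coordinate_in [simp]: "coordinate t \<in> tower_algebra"
  by (simp add: tower_algebra_def)

lemma coordinate_realize [simp]: "v \<in> points \<Longrightarrow> coordinate t (realize v) = v t"
  by (simp add: coordinate_def)

lemma coordinate_eqI:
  assumes "\<And>v. v \<in> points \<Longrightarrow> F (realize v) = v t"
  shows "(\<lambda>u\<in>realize ` points. F u) = coordinate t"
  unfolding coordinate_def using assms by (intro restrict_ext) auto

lemma compact_tower_space: "compact_space tower_space"
proof -
  have "continuous_on points realize"
    unfolding realize_def
    by (intro continuous_on_coordinatewise_then_product continuous_on_product_coordinates[THEN continuous_on_subset]) simp
  then have "compact (realize ` points)"
    using compact_points by (rule compact_continuous_image)
  then show ?thesis
    by (simp add: tower_space_def compact_space_subtopology)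
qed

lemma Hausdorff_tower_space: "Hausdorff_space tower_space"
  unfolding tower_space_def
  by (intro Hausdorff_space_subtopology)
     (simp add: Hausdorff_space_product_topology flip: euclidean_product_topology)

lemma coordinate_continuous: "coordinate t \<in> mspace (CX tower_space)"
proof -
  have "continuous_on (realize ` points) (\<lambda>u. u (code t))"
    by (intro continuous_on_product_coordinates[THEN continuous_on_subset]) simp
  then have "continuous_map tower_space euclidean (coordinate t)"
    unfolding tower_space_def by (simp add: coordinate_def cong: continuous_on_cong)
  moreover obtain K where "\<forall>v\<in>points. cmod (v t) \<le> K"
    using bounded_coordinate by blast
  then have "bounded (coordinate t ` realize ` points)"
    by (auto simp: bounded_iff)
  ultimately show ?thesis
    by (auto simp: coordinate_def)
qed

lemma fun_add_coordinate: "fun_add tower_space (coordinate a) (coordinate b) = coordinate (Plus a b)"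
  unfolding fun_add_def by (simp, rule coordinate_eqI) (simp add: points_Plus)

lemma fun_mult_coordinate: "fun_mult tower_space (coordinate a) (coordinate b) = coordinate (Times a b)"
  unfolding fun_mult_def by (simp, rule coordinate_eqI) (simp add: points_Times)

lemma fun_scale_coordinate: "fun_scale tower_space c (coordinate a) = coordinate (Times (Const c) a)"
  unfolding fun_scale_def by (simp, rule coordinate_eqI) (simp add: points_Times points_Const)

lemma coordinate_Const: "(\<lambda>x\<in>topspace tower_space. c) = coordinate (Const c)"
  by (simp, rule coordinate_eqI) (simp add: points_Const)

text \<open>
  A uniform limit of coordinate functions is approximated by coordinates at the rate prescribed for
  limits, so the corresponding limit expression names it. This makes the algebra complete in one
  stroke.
\<close>

lemma tower_algebra_closed: "closedin (mtopology_of (CX tower_space)) tower_algebra"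
proof -
  interpret C: Metric_space "mspace (CX tower_space)" "mdist (CX tower_space)"
    by (rule Metric_space_mspace_mdist)
  have sub: "tower_algebra \<subseteq> mspace (CX tower_space)"
    using coordinate_continuous by (auto simp: tower_algebra_def)
  have "f \<in> tower_algebra"
    if f: "f \<in> mspace (CX tower_space)"
      and near: "\<And>e. 0 < e \<Longrightarrow> \<not> disjnt tower_algebra (C.mball f e)" for f
  proof -
    \<comment> \<open>With this error, consecutive approximations differ by at most \<open>1 / 2 ^ n\<close>.\<close>
    have "\<exists>t. \<forall>v\<in>points. cmod (f (realize v) - v t) \<le> 1 / 2 ^ n / 2" for n :: nat
    proof -
      obtain t where t: "coordinate t \<in> C.mball f (1 / 2 ^ n / 2)"
        using near[of "1 / 2 ^ n / 2"] by (auto simp: disjnt_iff tower_algebra_def)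
      then have "mdist (CX tower_space) f (coordinate t) \<le> 1 / 2 ^ n / 2"
        unfolding C.in_mball by linarith
      then have "cmod (f (realize v) - v t) \<le> 1 / 2 ^ n / 2" if "v \<in> points" for v
        using mdist_cfunspace_imp_mdist_le[OF f coordinate_continuous[of t], of "1 / 2 ^ n / 2" "realize v"] that
        by (simp add: dist_norm)
      then show ?thesis by blast
    qed
    then obtain s where s: "\<And>n v. v \<in> points \<Longrightarrow> cmod (f (realize v) - v (s n)) \<le> 1 / 2 ^ n / 2"
      by metis
    have rapid: "rapidly_convergent s"
    proof (rule rapidly_convergentI)
      fix v n assume v: "v \<in> points"
      have "cmod (v (s n) - v (s (Suc n))) \<le> cmod (f (realize v) - v (s (Suc n))) + cmod (f (realize v) - v (s n))"
        using norm_triangle_ineq4[of "f (realize v) - v (s (Suc n))" "f (realize v) - v (s n)"] by simp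
      also have "\<dots> \<le> 1 / 2 ^ Suc n / 2 + 1 / 2 ^ n / 2"
        by (intro add_mono s v)
      also have "\<dots> \<le> 1 / 2 ^ n" by (simp add: field_simps)
      finally show "cmod (v (s n) - v (s (Suc n))) \<le> 1 / 2 ^ n" .
    qed
    have "f (realize v) = v (Limit s)" if v: "v \<in> points" for v
    proof -
      have "cmod (f (realize v) - v (Limit s)) \<le> 3 * (1/2) ^ n" for n
      proof -
        have "cmod (f (realize v) - v (Limit s)) \<le> cmod (f (realize v) - v (s n)) + cmod (v (Limit s) - v (s n))"
          using norm_triangle_ineq4[of "f (realize v) - v (s n)" "v (Limit s) - v (s n)"] by simp
        also have "\<dots> \<le> 1 / 2 ^ n / 2 + 2 / 2 ^ n"
          by (intro add_mono s v points_Limit rapid)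
        also have "\<dots> \<le> 3 * (1/2) ^ n"
          by (simp add: field_simps power_one_over)
        finally show ?thesis .
      qed
      moreover have "(\<lambda>n. 3 * (1/2) ^ n :: real) \<longlonglongrightarrow> 3 * 0"
        by (intro tendsto_intros LIMSEQ_power_zero) simp
      ultimately have "cmod (f (realize v) - v (Limit s)) \<le> 3 * 0"
        by (intro LIMSEQ_le_const[where X="\<lambda>n. 3 * (1/2) ^ n"]) blast+
      then show ?thesis by simp
    qed
    then have "(\<lambda>u\<in>realize ` points. f u) = coordinate (Limit s)"
      by (rule coordinate_eqI)
    moreover have "f \<in> extensional (realize ` points)"
      using f by simp
    ultimately have "f = coordinate (Limit s)"
      by (metis extensional_restrict)
    then show ?thesis by simp
  qed
  with sub show ?thesis
    unfolding mtopology_of_def C.closedin_metric by blast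
qed

lemma uniform_algebra_tower: "uniform_algebra tower_space tower_algebra"
proof -
  have "subalgebra tower_space tower_algebra"
    unfolding subalgebra_def
    using coordinate_continuous
    by (auto simp: tower_algebra_def fun_add_coordinate fun_mult_coordinate fun_scale_coordinate simp del: mspace_cfunspace)
  moreover have "\<exists>f\<in>tower_algebra. f x \<noteq> f y"
    if xy: "x \<in> realize ` points" "y \<in> realize ` points" "x \<noteq> y" for x y
  proof -
    obtain v w where vw: "x = realize v" "y = realize w" "v \<in> points" "w \<in> points"
      using xy by blast
    with \<open>x \<noteq> y\<close> obtain t where "v t \<noteq> w t" by (metis ext)
    then show ?thesis
      using vw by (intro bexI[of _ "coordinate t"]) auto
  qed
  ultimately show ?thesis
    unfolding uniform_algebra_def
    by (auto simp: compact_tower_space Hausdorff_tower_space tower_algebra_closed coordinate_Const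
        simp del: topspace_tower_space) (simp_all add: coordinate_Const[simplified])
qed

lemma topspace_maximal_ideal_space [simp]:
  "topspace (maximal_ideal_space X B) = characters X B"
  by (auto simp: maximal_ideal_space_def characters_def PiE_def)

definition evaluation :: "(expr \<Rightarrow> complex) \<Rightarrow> ((real \<Rightarrow> complex) \<Rightarrow> complex) \<Rightarrow> complex" where
  "evaluation v = (\<lambda>f\<in>tower_algebra. f (realize v))"

lemma evaluation_coordinate [simp]: "v \<in> points \<Longrightarrow> evaluation v (coordinate t) = v t"
  by (simp add: evaluation_def)

lemma evaluation_character:
  assumes v: "v \<in> points"
  shows "evaluation v \<in> characters tower_space tower_algebra"
proof -
  have "evaluation v (coordinate (Const 1)) \<noteq> 0"
    using v by (simp add: points_Const)
  then have "\<exists>f\<in>tower_algebra. evaluation v f \<noteq> 0"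
    using coordinate_in by blast
  then show ?thesis
    unfolding characters_def linear_functional_def
    using v by (auto simp: evaluation_def tower_algebra_def fun_add_coordinate fun_mult_coordinate
        fun_scale_coordinate points_Plus points_Times points_Const)
qed

section \<open>A nontrivial Gleason part\<close>

lemma dual_norm_evaluation_difference:
  assumes p: "p \<in> points" "p Base = 0" and q: "q \<in> points" "q Base = 1/2"
  shows "dual_norm tower_space tower_algebra (\<lambda>f. evaluation p f - evaluation q f) \<le> 1"
  unfolding dual_norm_def
proof (rule SUP_least)
  fix f assume "f \<in> {f \<in> tower_algebra. sup_norm tower_space f \<le> 1}"
  then obtain t where t: "f = coordinate t" "sup_norm tower_space (coordinate t) \<le> 1"
    by (auto simp: tower_algebra_def)
  have "cmod (v t) \<le> 1" if "v \<in> points" for v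
    using mdist_cfunspace_imp_mdist_le[OF coordinate_continuous[of t] coordinate_continuous[of "Const 0"], of 1 "realize v"]
      t(2) that
    unfolding sup_norm_def coordinate_Const by (simp add: points_Const)
  then have "cmod (p t - q t) \<le> 1"
    using difference_bound[OF p q] by blast
  then show "ennreal (cmod (evaluation p f - evaluation q f)) \<le> 1"
    using p q t(1) by (simp add: ennreal_le_1)
qed

lemma nontrivial_part_tower: "\<exists>P\<in>gleason_parts tower_space tower_algebra. nontrivial_part P"
proof -
  obtain p where p: "p \<in> points" "p Base = 0"
    using point_over[of 0] by auto
  obtain q where q: "q \<in> points" "q Base = 1/2"
    using point_over[of "1/2"] by auto
  let ?R = "gleason_rel tower_space tower_algebra"
  have chars: "evaluation p \<in> characters tower_space tower_algebra"
    "evaluation q \<in> characters tower_space tower_algebra"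
    using p q evaluation_character by auto
  have "dual_norm tower_space tower_algebra (\<lambda>f. evaluation p f - evaluation p f) \<le> 0"
    unfolding dual_norm_def by (rule SUP_least) simp
  then have pp: "(evaluation p, evaluation p) \<in> ?R"
    using chars by (simp add: gleason_rel_def)
  have "dual_norm tower_space tower_algebra (\<lambda>f. evaluation p f - evaluation q f) < 2"
    using dual_norm_evaluation_difference[OF p q] by (rule le_less_trans) simp
  then have pq: "(evaluation p, evaluation q) \<in> ?R"
    using chars by (simp add: gleason_rel_def)
  have "evaluation p (coordinate Base) = 0" "evaluation q (coordinate Base) = 1/2"
    using p q by (simp_all only: evaluation_coordinate)
  then have "evaluation p \<noteq> evaluation q" by auto
  then have "nontrivial_part (?R `` {evaluation p})"
    using pp pq unfolding nontrivial_part_def by blast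
  moreover have "?R `` {evaluation p} \<in> gleason_parts tower_space tower_algebra"
    unfolding gleason_parts_def using chars by (intro quotientI) simp
  ultimately show ?thesis by blast
qed

section \<open>Absence of point derivations\<close>

text \<open>
  \<open>\<Phi>\<close> is a character and \<open>\<Delta>\<close> a derivation at it, both read as functions of expressions that
  only depend on the named function. The multipliers \<open>h\<close> and \<open>k\<close> bring \<open>f\<close> into the ideal of
  functions vanishing at \<open>p\<close> and \<open>q\<close>, whose elements are squares.
\<close>

lemma derivation_vanishes:
  fixes \<Phi> \<Delta> :: "expr \<Rightarrow> complex"
  assumes cong: "\<And>a b. (\<And>v. v \<in> points \<Longrightarrow> v a = v b) \<Longrightarrow> \<Phi> a = \<Phi> b \<and> \<Delta> a = \<Delta> b"
    and \<Phi>: "\<And>c. \<Phi> (Const c) = c" "\<And>a b. \<Phi> (Plus a b) = \<Phi> a + \<Phi> b" "\<And>a b. \<Phi> (Times a b) = \<Phi> a * \<Phi> b"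
    and \<Delta>: "\<And>c. \<Delta> (Const c) = 0" "\<And>a b. \<Delta> (Plus a b) = \<Delta> a + \<Delta> b"
      "\<And>a b. \<Delta> (Times a b) = \<Delta> a * \<Phi> b + \<Phi> a * \<Delta> b"
  shows "\<Delta> t = 0"
proof -
  obtain p where p: "p \<in> points" "p Base = 0"
    using point_over[of 0] by auto
  obtain q where q: "q \<in> points" "q Base = 1/2"
    using point_over[of "1/2"] by auto
  define f where "f = Plus t (Const (- \<Phi> t))"
  have f: "\<Phi> f = 0" "\<Delta> f = \<Delta> t"
    by (simp_all add: f_def \<Phi> \<Delta>)
  have multiplier: "\<exists>h. \<Phi> h \<noteq> 0 \<and> r f * r h = 0" if r: "r \<in> points" for r
  proof (cases "\<exists>a. \<Phi> a \<noteq> r a")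
    case True
    then obtain a where "\<Phi> a \<noteq> r a" by blast
    then show ?thesis
      using r by (intro exI[of _ "Plus a (Const (- r a))"]) (simp add: \<Phi> points_Plus points_Const)
  next
    case False
    then have "r f = 0"
      using f(1) by metis
    moreover have "\<Phi> (Const 1) \<noteq> 0"
      by (simp add: \<Phi>)
    ultimately show ?thesis by auto
  qed
  obtain h where h: "\<Phi> h \<noteq> 0" "p f * p h = 0" using multiplier[OF p(1)] by blast
  obtain k where k: "\<Phi> k \<noteq> 0" "q f * q k = 0" using multiplier[OF q(1)] by blast
  define w where "w = Times f (Times h k)"
  have "p w = 0" "q w = 0"
    using h k p q by (auto simp: w_def points_Times)
  then have "vanishing w"
    using point_over_unique[OF p(1)] point_over_unique[OF q(1)] p(2) q(2) by (intro vanishingI) auto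
  then have "\<Phi> (Times (Root w) (Root w)) = \<Phi> w \<and> \<Delta> (Times (Root w) (Root w)) = \<Delta> w"
    by (intro cong) (simp add: points_Times points_Root flip: power2_eq_square)
  moreover have "\<Phi> w = 0" "\<Delta> w = \<Delta> t * (\<Phi> h * \<Phi> k)"
    using f by (simp_all add: w_def \<Phi> \<Delta>)
  moreover have "\<Phi> (Times (Root w) (Root w)) = \<Phi> (Root w) * \<Phi> (Root w)"
    and "\<Delta> (Times (Root w) (Root w)) = 2 * \<Phi> (Root w) * \<Delta> (Root w)"
    by (simp_all add: \<Phi> \<Delta>)
  ultimately have "\<Delta> t * (\<Phi> h * \<Phi> k) = 0"
    by auto
  then show ?thesis using h(1) k(1) by simp
qed

lemma no_point_derivation_tower:
  assumes \<phi>: "\<phi> \<in> characters tower_space tower_algebra"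
    and D: "point_derivation tower_space tower_algebra \<phi> D"
  shows "D (coordinate t) = 0"
proof -
  have \<phi>_add: "\<phi> (coordinate (Plus a b)) = \<phi> (coordinate a) + \<phi> (coordinate b)"
    and \<phi>_mult: "\<phi> (coordinate (Times a b)) = \<phi> (coordinate a) * \<phi> (coordinate b)" for a b
    using \<phi> unfolding characters_def linear_functional_def
    by (auto simp flip: fun_add_coordinate fun_mult_coordinate)
  have \<phi>_scale: "\<phi> (coordinate (Times (Const c) a)) = c * \<phi> (coordinate a)" for a c
    using \<phi> unfolding characters_def linear_functional_def fun_scale_coordinate[symmetric] by auto
  have D_add: "D (coordinate (Plus a b)) = D (coordinate a) + D (coordinate b)"
    and D_mult: "D (coordinate (Times a b)) = D (coordinate a) * \<phi> (coordinate b) + \<phi> (coordinate a) * D (coordinate b)"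
    for a b
    using D unfolding point_derivation_def linear_functional_def
    by (auto simp flip: fun_add_coordinate fun_mult_coordinate)
  have D_scale: "D (coordinate (Times (Const c) a)) = c * D (coordinate a)" for a c
    using D unfolding point_derivation_def linear_functional_def fun_scale_coordinate[symmetric] by auto
  obtain e where e: "\<phi> (coordinate e) \<noteq> 0"
    using \<phi> unfolding characters_def tower_algebra_def by blast
  have \<phi>_Const: "\<phi> (coordinate (Const c)) = c" for c
    using \<phi>_mult[of "Const c" e] \<phi>_scale[of c e] e by simp
  have D_Const: "D (coordinate (Const c)) = 0" for c
    using D_mult[of "Const c" e] D_scale[of c e] e by (simp add: \<phi>_Const)
  show ?thesis
  proof (rule derivation_vanishes[where \<Phi>="\<lambda>a. \<phi> (coordinate a)" and \<Delta>="\<lambda>a. D (coordinate a)"])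
    fix a b assume "\<And>v. v \<in> points \<Longrightarrow> v a = v b"
    then have "coordinate a = coordinate b"
      unfolding coordinate_def by (intro restrict_ext) auto
    then show "\<phi> (coordinate a) = \<phi> (coordinate b) \<and> D (coordinate a) = D (coordinate b)" by simp
  qed (simp_all add: \<phi>_add \<phi>_mult \<phi>_Const D_add D_mult D_Const)
qed

theorem theorem1p2:
  shows "\<exists>(X :: (real \<Rightarrow> complex) topology) (B :: ((real \<Rightarrow> complex) \<Rightarrow> complex) set).
           compact_space X \<and> Hausdorff_space X \<and> uniform_algebra X B \<and>
           (\<exists>P\<in>gleason_parts X B. nontrivial_part P) \<and>
           (\<forall>\<phi>\<in>topspace (maximal_ideal_space X B).
              \<not> (\<exists>D. point_derivation X B \<phi> D \<and> (\<exists>f\<in>B. D f \<noteq> 0)))"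
proof (intro exI conjI ballI notI)
  show "compact_space tower_space" by (rule compact_tower_space)
  show "Hausdorff_space tower_space" by (rule Hausdorff_tower_space)
  show "uniform_algebra tower_space tower_algebra" by (rule uniform_algebra_tower)
  show "\<exists>P\<in>gleason_parts tower_space tower_algebra. nontrivial_part P" by (rule nontrivial_part_tower)
  fix \<phi>
  assume "\<phi> \<in> topspace (maximal_ideal_space tower_space tower_algebra)"
    and "\<exists>D. point_derivation tower_space tower_algebra \<phi> D \<and> (\<exists>f\<in>tower_algebra. D f \<noteq> 0)"
  then show False
    using no_point_derivation_tower by (auto simp: tower_algebra_def)
qed

end
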